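(* Let $f$ be convex, let $x^\star$ be an arbitrary solution of $\min_{x\in\mathrm{lin}(\mathcal A)}f(x)$, and let $R_{\mathcal B}$ be the level set radius $$R_{\mathcal B}=\max_{x\in\mathrm{lin}(\mathcal A),\ f(x)\le f(x_0)}\|x-x^\star\|_{\mathcal B}.$$ If $x_t$ denotes the iterate generated by AdaMP (described in the context) after $t\ge1$ iterations and $\beta=\delta/R_{\mathcal B}$, then $$f(x_t)-f(x^\star)\le\frac{2\overline L_t\,\mathrm{radius}(\mathcal A)^2}{\beta^2t+\beta}+\frac{2(1-\beta)}{\beta^2t^2+\beta t}\,h_0=\mathcal O\Big(\frac1{\beta^2t}\Big).$$
   Context: Setting. $\mathcal A\subset\mathbb R^p$ is a bounded (possibly infinite) set of "atoms", $\mathrm{lin}(\mathcal A)$ its linear span, $\mathcal B=\mathcal A\cup(-\mathcal A)$. $\|\cdot\|$ is the Euclidean norm, $\mathrm{radius}(\mathcal A)=\sup_{a\in\mathcal A}\|a\|$, and $\|x\|_{\mathcal B}=\inf\{c>0: x\in c\,\mathrm{conv}(\mathcal B)\}$ is the atomic norm of $\mathcal B$ on $\mathrm{lin}(\mathcal A)$. The objective $f$ is $L$-smooth: it is differentiable with $\|\nabla f(x)-\nabla f(y)\|\le L\|x-y\|$ for all $x,y$ in the domain. $h_0=f(x_0)-f(x^\star)$. AdaMP. Inputs: $x_0\in\mathcal A$, $L_{-1}>0$, tolerance $\varepsilon\ge 0$, subproblem quality $\delta\in(0,1]$, parameters $\tau>1$, $0<\eta\le1$. At iteration $t=0,1,\dots$: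 choose any $s_t\in\mathcal B$ with $\langle\nabla f(x_t),s_t\rangle\le\delta\min_{s\in\mathcal B}\langle\nabla f(x_t),s\rangle$; set $d_t=s_t$ and $g_t=\langle-\nabla f(x_t),d_t\rangle$; if $g_t\le\delta\varepsilon$, stop and return $x_t$. Otherwise choose any $M\in[\eta L_{t-1},L_{t-1}]$ and set $\gamma=g_t/(M\|d_t\|^2)$; as long as the sufficient decrease condition $f(x_t+\gamma d_t)\le f(x_t)-\gamma g_t+\frac{\gamma^2M}{2}\|d_t\|^2$ fails, replace $M$ by $\tau M$ and recompute $\gamma=g_t/(M\|d_t\|^2)$. When the condition holds, set $\gamma_t=\gamma$, $L_t=M$, $x_{t+1}=x_t+\gamma_td_t$. $\overline L_t=\frac1t\sum_{k=0}^{t-1}L_k$ is the average of the Lipschitz estimates. *)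

theory Defs
  imports "HOL-Analysis.Analysis"
begin

definition gradient :: "('a::real_inner \<Rightarrow> real) \<Rightarrow> 'a \<Rightarrow> 'a" where
  "gradient f x = (THE g. GDERIV f x :> g)"

definition smooth_fun_on :: "real \<Rightarrow> 'a::real_inner set \<Rightarrow> ('a \<Rightarrow> real) \<Rightarrow> bool" where
  "smooth_fun_on L D f \<longleftrightarrow>
     (\<forall>x\<in>D. f differentiable (at x)) \<and> L-lipschitz_on D (gradient f)"

definition sym_atoms :: "'a::real_inner set \<Rightarrow> 'a set" where
  "sym_atoms A = A \<union> uminus ` A"

definition atoms_radius :: "'a::real_inner set \<Rightarrow> real" where
  "atoms_radius A = (SUP a\<in>A. norm a)"

text \<open>Intended for \<open>x\<close> in the linear span of a symmetric set \<open>B\<close>: outside the span the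
  infimum is over the empty set and its value carries no meaning.\<close>

definition atomic_norm :: "'a::real_inner set \<Rightarrow> 'a \<Rightarrow> real" where
  "atomic_norm B x = Inf {c. c > 0 \<and> x \<in> (\<lambda>y. c *\<^sub>R y) ` (convex hull B)}"

text \<open>A relation rather than a function, so that \<open>R\<close> is really a maximum: it is attained and no
  junk value arises for an unbounded level set.\<close>

definition is_level_set_radius ::
    "'a::real_inner set \<Rightarrow> ('a \<Rightarrow> real) \<Rightarrow> 'a \<Rightarrow> 'a \<Rightarrow> real \<Rightarrow> bool" where
  "is_level_set_radius A f x0 xstar R \<longleftrightarrow>
     (\<exists>x\<in>span A. f x \<le> f x0 \<and> R = atomic_norm (sym_atoms A) (x - xstar)) \<and>
     (\<forall>x\<in>span A. f x \<le> f x0 \<longrightarrow> atomic_norm (sym_atoms A) (x - xstar) \<le> R)"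

text \<open>\<open>A\<close> need not be closed, so the minimum over the atoms is written as an infimum.\<close>

definition approx_lmo :: "'a::real_inner set \<Rightarrow> ('a \<Rightarrow> real) \<Rightarrow> real \<Rightarrow> 'a \<Rightarrow> 'a \<Rightarrow> bool" where
  "approx_lmo A f \<delta> x s \<longleftrightarrow>
     s \<in> sym_atoms A \<and>
     gradient f x \<bullet> s \<le> \<delta> * (INF s'\<in>sym_atoms A. gradient f x \<bullet> s')"

definition mp_step_size :: "real \<Rightarrow> 'a::real_inner \<Rightarrow> real \<Rightarrow> real" where
  "mp_step_size g d M = g / (M * (norm d)\<^sup>2)"

definition sufficient_decrease ::
    "('a::real_inner \<Rightarrow> real) \<Rightarrow> 'a \<Rightarrow> 'a \<Rightarrow> real \<Rightarrow> real \<Rightarrow> bool" where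
  "sufficient_decrease f x d g M \<longleftrightarrow>
     (let \<gamma> = mp_step_size g d M in
       f (x + \<gamma> *\<^sub>R d) \<le> f x - \<gamma> * g + \<gamma>\<^sup>2 * M / 2 * (norm d)\<^sup>2)"

text \<open>\<open>backtracks f x d g \<tau> M M'\<close>: the line search started with the estimate \<open>M\<close>
  terminates and returns the estimate \<open>M'\<close>.\<close>

inductive backtracks ::
    "('a::real_inner \<Rightarrow> real) \<Rightarrow> 'a \<Rightarrow> 'a \<Rightarrow> real \<Rightarrow> real \<Rightarrow> real \<Rightarrow> real \<Rightarrow> bool"
  for f x d g \<tau> where
  accept: "sufficient_decrease f x d g M \<Longrightarrow> backtracks f x d g \<tau> M M"
| increase: "\<not> sufficient_decrease f x d g M \<Longrightarrow> backtracks f x d g \<tau> (\<tau> * M) M'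
    \<Longrightarrow> backtracks f x d g \<tau> M M'"

text \<open>One completed (that is, non-stopping) iteration, taking the iterate \<open>x\<close> and the previous
  Lipschitz estimate \<open>Lprev\<close> to the next iterate \<open>x'\<close> and the new estimate \<open>Lnew\<close>. It is a
  relation because the direction and the initial value of \<open>M\<close> may be chosen freely.\<close>

definition adamp_step ::
    "'a::real_inner set \<Rightarrow> ('a \<Rightarrow> real) \<Rightarrow> real \<Rightarrow> real \<Rightarrow> real \<Rightarrow> real \<Rightarrow>
     'a \<Rightarrow> real \<Rightarrow> 'a \<Rightarrow> real \<Rightarrow> bool" where
  "adamp_step A f \<delta> \<epsilon> \<tau> \<eta> x Lprev x' Lnew \<longleftrightarrow>
     (\<exists>d M. approx_lmo A f \<delta> x d \<and>
        (let g = (- gradient f x) \<bullet> d in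
           g > \<delta> * \<epsilon> \<and>
           \<eta> * Lprev \<le> M \<and> M \<le> Lprev \<and>
           backtracks f x d g \<tau> M Lnew \<and>
           x' = x + mp_step_size g d Lnew *\<^sub>R d))"

text \<open>\<open>x 0, \<dots>, x t\<close> and \<open>Ls 0, \<dots>, Ls (t - 1)\<close> are produced by \<open>t\<close> completed iterations;
  \<open>L_init\<close> is the initial estimate, which has index \<open>-1\<close> in the algorithm.\<close>

definition adamp_run ::
    "'a::real_inner set \<Rightarrow> ('a \<Rightarrow> real) \<Rightarrow> real \<Rightarrow> real \<Rightarrow> real \<Rightarrow> real \<Rightarrow> real \<Rightarrow>
     nat \<Rightarrow> (nat \<Rightarrow> 'a) \<Rightarrow> (nat \<Rightarrow> real) \<Rightarrow> bool" where
  "adamp_run A f \<delta> \<epsilon> \<tau> \<eta> L_init t x Ls \<longleftrightarrow>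
     x 0 \<in> A \<and>
     (\<forall>k<t. adamp_step A f \<delta> \<epsilon> \<tau> \<eta>
        (x k) (if k = 0 then L_init else Ls (k - 1)) (x (Suc k)) (Ls k))"

end

theory Submission
  imports Defs
begin

text \<open>The proof rests on one recursion for the gaps \<open>h k = f (x k) - f xstar\<close>. With \<open>\<beta> = \<delta> / R\<close> and
  \<open>r\<close> the radius of the atoms, every \<open>\<gamma> \<ge> 0\<close> satisfies
  \<open>h (k + 1) \<le> h k - \<gamma> \<beta> h k + \<gamma>\<^sup>2 L\<^sub>k r\<^sup>2 / 2\<close>.
  Two facts give it. Convexity, the duality between the atomic norm and the oracle, and the level
  set radius show that the slope along the chosen direction is at least \<open>\<beta> h k\<close>
  (\<open>gap_le_direction\<close>); and the step size minimises the quadratic model for which sufficient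
  decrease was tested, so that \<open>\<gamma>\<close> in the resulting estimate is free
  (\<open>sufficient_decrease_progress\<close>). Monotonicity of \<open>f\<close> along the run keeps the iterates in the
  level set.

  What remains concerns real sequences. The bound is equivalent to
  \<open>\<beta> t (\<beta> t + 1) / 2 * h t \<le> r\<^sup>2 (\<Sum>k<t. L\<^sub>k) + (1 - \<beta>) h 0\<close>, and is obtained by multiplying the
  recursion by weights chosen so that the sum telescopes. For \<open>\<beta> \<le> 1\<close> one family of weights works
  from the beginning (\<open>gap_rate_at_most_one\<close>). But \<open>\<beta> > 1\<close> is possible: it occurs as soon as
  the whole level set lies within atomic distance less than \<open>\<delta>\<close> of the minimiser. Then the
  coefficient of \<open>h 0\<close> is negative, and a different family with a separate first step is needed
  (\<open>gap_rate_at_least_one\<close>).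

  For the order of the bound, the accepted estimates never exceed \<open>max L_init (\<tau> L)\<close>
  (\<open>backtracks_bounds\<close>), and since no step can make the gap negative,
  \<open>\<beta>\<^sup>2 h 0 \<le> 2 L\<^sub>0 r\<^sup>2\<close> (\<open>initial_gap_bound\<close>). The latter controls the term with \<open>1 - \<beta>\<close>
  uniformly in \<open>\<beta>\<close>.\<close>

section \<open>Gradients of convex and of smooth functions\<close>

text \<open>The gradient is the Riesz representative of the derivative; \<open>gradient\<close> picks it by a definite
  description, so both existence and uniqueness are needed before anything can be said about it.\<close>

lemma GDERIV_gradient:
  fixes f :: "'a::euclidean_space \<Rightarrow> real"
  assumes "f differentiable (at x)"
  shows "GDERIV f x :> gradient f x"
proof -
  obtain f' where f': "(f has_derivative f') (at x)"
    using assms by (auto simp: differentiable_def)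
  define g where "g = (\<Sum>b\<in>Basis. f' b *\<^sub>R b)"
  have "f' h = h \<bullet> g" for h
  proof -
    interpret linear f' using f' by (rule has_derivative_linear)
    have "f' h = f' (\<Sum>b\<in>Basis. (h \<bullet> b) *\<^sub>R b)"
      by (simp add: euclidean_representation)
    then show ?thesis
      by (simp add: sum scale g_def inner_sum_right mult.commute)
  qed
  then have "f' = (\<lambda>h. h \<bullet> g)" by blast
  with f' have g: "GDERIV f x :> g" by (simp add: gderiv_def)
  have "g' = g" if "GDERIV f x :> g'" for g'
  proof -
    have "(\<lambda>h. h \<bullet> g') = (\<lambda>h. h \<bullet> g)"
      using that g unfolding gderiv_def by (rule has_derivative_unique)
    then have "\<forall>h. h \<bullet> g' = h \<bullet> g" by meson
    then show ?thesis by (simp only: vector_eq_ldot)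
  qed
  with g show ?thesis unfolding gradient_def by (rule theI)
qed

lemma DERIV_along_line:
  fixes f :: "'a::euclidean_space \<Rightarrow> real"
  assumes "f differentiable (at (x + s *\<^sub>R h))"
  shows "((\<lambda>s. f (x + s *\<^sub>R h)) has_real_derivative gradient f (x + s *\<^sub>R h) \<bullet> h) (at s)"
proof -
  have f: "(f has_derivative (\<lambda>k. k \<bullet> gradient f (x + s *\<^sub>R h))) (at (x + s *\<^sub>R h))"
    using GDERIV_gradient[OF assms] by (simp add: gderiv_def)
  have "((\<lambda>s. x + s *\<^sub>R h) has_derivative (\<lambda>s. s *\<^sub>R h)) (at s)"
    by (auto intro!: derivative_eq_intros)
  from diff_chain_at[OF this f] show ?thesis
    by (simp add: has_field_derivative_def o_def inner_commute mult_commute_abs)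
qed

text \<open>Restricting \<open>f\<close> to the line through \<open>x\<close> and \<open>y\<close> reduces this to the one-dimensional tangent
  inequality. Openness of \<open>D\<close> makes the parameter \<open>0\<close> an interior point of the restricted domain.\<close>

lemma convex_above_gradient:
  fixes f :: "'a::euclidean_space \<Rightarrow> real"
  assumes "open D" "convex_on D f" "x \<in> D" "y \<in> D" "f differentiable (at x)"
  shows "f x + gradient f x \<bullet> (y - x) \<le> f y"
proof -
  define l where "l s = x + s *\<^sub>R (y - x)" for s :: real
  define T where "T = l -` D"
  have l_affine: "l (a * u + b * v) = a *\<^sub>R l u + b *\<^sub>R l v" if "a + b = 1" for a b u v
  proof -
    have "a *\<^sub>R l u + b *\<^sub>R l v = (a + b) *\<^sub>R x + (a * u + b * v) *\<^sub>R (y - x)"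
      by (simp add: l_def algebra_simps)
    then show ?thesis using that by (simp add: l_def)
  qed
  have "convex D" using assms(2) by (rule convex_on_imp_convex)
  then have "convex T"
    by (auto simp: T_def convex_def l_affine)
  have "convex_on T (\<lambda>s. f (l s))"
    using assms(2) \<open>convex T\<close>
    by (auto simp: convex_on_def T_def l_affine)
  moreover have "connected T" using \<open>convex T\<close> by (rule convex_connected)
  moreover have "open T"
    unfolding T_def l_def by (intro open_vimage assms continuous_intros)
  then have "0 \<in> interior T" using assms(3) by (simp add: interior_open T_def l_def)
  moreover have "1 \<in> T" using assms(4) by (simp add: T_def l_def)
  moreover have "((\<lambda>s. f (l s)) has_real_derivative gradient f x \<bullet> (y - x)) (at 0 within T)"
    using DERIV_along_line[of f x 0 "y - x"] assms(5)
    by (auto simp: l_def intro: has_field_derivative_at_within)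
  ultimately have "f (l 1) - f (l 0) \<ge> (gradient f x \<bullet> (y - x)) * (1 - 0)"
    by (rule convex_on_imp_above_tangent)
  then show ?thesis by (simp add: l_def)
qed

text \<open>The difference of the two sides along the segment has derivative
  \<open>\<langle>\<nabla>f (x + s h) - \<nabla>f x, h\<rangle> - L s \<parallel>h\<parallel>\<^sup>2\<close>, which Cauchy-Schwarz and the Lipschitz
  bound make nonpositive.\<close>

lemma smooth_descent:
  fixes f :: "'a::euclidean_space \<Rightarrow> real"
  assumes f: "smooth_fun_on L D f" and seg: "\<And>s. 0 \<le> s \<Longrightarrow> s \<le> 1 \<Longrightarrow> x + s *\<^sub>R h \<in> D"
  shows "f (x + h) \<le> f x + gradient f x \<bullet> h + L / 2 * (norm h)\<^sup>2"
proof -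
  define \<psi> where
    "\<psi> s = f (x + s *\<^sub>R h) - s * (gradient f x \<bullet> h) - L / 2 * s\<^sup>2 * (norm h)\<^sup>2" for s :: real
  have "\<psi> 1 \<le> \<psi> 0"
  proof (rule DERIV_nonpos_imp_nonincreasing[of 0 1 \<psi>])
    fix s :: real assume s: "0 \<le> s" "s \<le> 1"
    let ?y = "x + s *\<^sub>R h"
    let ?d = "gradient f ?y \<bullet> h - gradient f x \<bullet> h - L * s * (norm h)\<^sup>2"
    have D: "x \<in> D" "?y \<in> D" using seg[of 0] seg[OF s] by auto
    have "f differentiable (at ?y)" using f D by (auto simp: smooth_fun_on_def)
    then have "(\<psi> has_real_derivative ?d) (at s)"
      unfolding \<psi>_def by (auto intro!: derivative_eq_intros DERIV_along_line)
    moreover have "(gradient f ?y - gradient f x) \<bullet> h \<le> dist (gradient f ?y) (gradient f x) * norm h"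
      by (simp add: dist_norm norm_cauchy_schwarz)
    moreover have "dist (gradient f ?y) (gradient f x) \<le> L * (s * norm h)"
      using lipschitz_onD[of L D "gradient f" ?y x] f D s
      by (simp add: smooth_fun_on_def dist_norm)
    then have "dist (gradient f ?y) (gradient f x) * norm h \<le> L * (s * norm h) * norm h"
      by (rule mult_right_mono) simp
    ultimately have "(\<psi> has_real_derivative ?d) (at s)" "?d \<le> 0"
      by (simp_all add: power2_eq_square inner_diff_left mult_ac)
    then show "\<exists>d. (\<psi> has_real_derivative d) (at s) \<and> d \<le> 0" by blast
  qed simp
  then show ?thesis by (simp add: \<psi>_def)
qed

section \<open>The atomic norm as the dual of the linear minimisation oracle\<close>

text \<open>The positive multiples of the convex hull of a nonempty symmetric set form a subspace. This
  ensures that the infimum in the atomic norm ranges over a nonempty set for points of the span.\<close>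

lemma span_subset_cone_sym_atoms:
  assumes "A \<noteq> {}" "x \<in> span A"
  shows "\<exists>c>0. x \<in> (\<lambda>y. c *\<^sub>R y) ` (convex hull sym_atoms A)"
proof -
  let ?H = "convex hull sym_atoms A"
  define S where "S = {x. \<exists>c>0. \<exists>y\<in>?H. x = c *\<^sub>R y}"
  have sub: "sym_atoms A \<subseteq> ?H" by (rule hull_subset)
  have "uminus ` ?H = convex hull (uminus ` sym_atoms A)"
    by (rule convex_hull_linear_image) (simp add: module_hom_uminus linear_iff_module_hom)
  also have "uminus ` sym_atoms A = sym_atoms A"
    by (simp add: sym_atoms_def image_Un image_image Un_commute)
  finally have neg: "- y \<in> ?H" if "y \<in> ?H" for y
    using that by blast
  \<comment> \<open>The origin is the midpoint of an atom and its negative.\<close>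
  obtain a where a: "a \<in> A" using assms(1) by auto
  then have "a \<in> ?H" using sub by (auto simp: sym_atoms_def)
  then have "(1/2) *\<^sub>R a + (1/2) *\<^sub>R (- a) \<in> ?H"
    by (intro convexD[OF convex_convex_hull] neg) auto
  then have zero_H: "0 \<in> ?H" by simp
  have "subspace S"
  proof (rule subspaceI)
    show "0 \<in> S" using zero_H by (auto simp: S_def intro: exI[of _ 1])
  next
    fix u v assume "u \<in> S" "v \<in> S"
    then obtain c y c' y' where *: "c > 0" "y \<in> ?H" "u = c *\<^sub>R y" "c' > 0" "y' \<in> ?H" "v = c' *\<^sub>R y'"
      by (auto simp: S_def)
    have "(c / (c + c')) *\<^sub>R y + (c' / (c + c')) *\<^sub>R y' \<in> ?H"
      using * by (intro convexD[OF convex_convex_hull]) (auto simp: add_divide_distrib[symmetric])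
    moreover have "u + v = (c + c') *\<^sub>R ((c / (c + c')) *\<^sub>R y + (c' / (c + c')) *\<^sub>R y')"
      using * by (simp add: scaleR_add_right)
    ultimately show "u + v \<in> S" using * unfolding S_def
      by (intro CollectI exI[of _ "c + c'"]) (auto intro: add_pos_pos)
  next
    fix k :: real and u assume "u \<in> S"
    then obtain c y where *: "c > 0" "y \<in> ?H" "u = c *\<^sub>R y" by (auto simp: S_def)
    consider "k = 0" | "k > 0" | "k < 0" using linorder_less_linear[of k 0] by blast
    then show "k *\<^sub>R u \<in> S"
    proof cases
      case 1 then show ?thesis using zero_H by (auto simp: S_def intro: exI[of _ 1])
    next
      case 2 then show ?thesis using * unfolding S_def
        by (intro CollectI exI[of _ "k * c"]) auto
    next
      case 3 then show ?thesis using * neg unfolding S_def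
        by (intro CollectI exI[of _ "- k * c"] conjI bexI[of _ "- y"]) (auto simp: mult_neg_pos)
    qed
  qed
  moreover have "A \<subseteq> S"
  proof
    fix b assume "b \<in> A"
    then have "b \<in> ?H" using sub by (auto simp: sym_atoms_def)
    then show "b \<in> S" unfolding S_def by (intro CollectI exI[of _ 1] bexI[of _ b]) auto
  qed
  ultimately have "span A \<subseteq> S" by (intro span_minimal)
  with assms(2) obtain c y where "c > 0" "y \<in> ?H" "x = c *\<^sub>R y" unfolding S_def by blast
  then show ?thesis by blast
qed

text \<open>This is the duality between the atomic norm and the support function of the symmetrised
  atoms: if \<open>x = c y\<close> with \<open>y\<close> in the hull then \<open>v \<bullet> x \<le> c G\<close>, and \<open>c\<close> may approach the norm.\<close>

lemma inner_le_atomic_norm: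
  assumes "A \<noteq> {}" "x \<in> span A" and G: "\<And>a. a \<in> A \<Longrightarrow> \<bar>v \<bullet> a\<bar> \<le> G"
  shows "v \<bullet> x \<le> G * atomic_norm (sym_atoms A) x"
proof -
  let ?C = "{c. c > 0 \<and> x \<in> (\<lambda>y. c *\<^sub>R y) ` (convex hull sym_atoms A)}"
  have "G \<ge> 0" using assms(1) G by fastforce
  have le: "v \<bullet> x \<le> G * c" if c: "c \<in> ?C" for c
  proof -
    obtain y where y: "y \<in> convex hull sym_atoms A" "x = c *\<^sub>R y" and "c > 0" using c by blast
    have "sym_atoms A \<subseteq> {z. v \<bullet> z \<le> G}"
      using G by (force simp: sym_atoms_def abs_le_iff)
    then have "convex hull sym_atoms A \<subseteq> {z. v \<bullet> z \<le> G}"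
      by (rule hull_minimal) (rule convex_halfspace_le)
    then have "v \<bullet> y \<le> G" using y by auto
    then show ?thesis using y \<open>c > 0\<close> by (simp add: mult.commute)
  qed
  have ne: "?C \<noteq> {}" using span_subset_cone_sym_atoms[OF assms(1,2)] by auto
  show ?thesis
  proof (cases "G = 0")
    case True
    then show ?thesis using le ne by fastforce
  next
    case False
    with \<open>G \<ge> 0\<close> have "G > 0" by simp
    have "(v \<bullet> x) / G \<le> Inf ?C"
      using ne le \<open>G > 0\<close> by (intro cInf_greatest) (auto simp: divide_le_eq mult.commute)
    then show ?thesis using \<open>G > 0\<close> by (simp add: atomic_norm_def divide_le_eq mult.commute)
  qed
qed

text \<open>The oracle is compared with \<open>a\<close> and with \<open>- a\<close>, both of which belong to the symmetrised set;
  boundedness keeps the infimum over the atoms meaningful.\<close>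

lemma approx_lmo_gap:
  assumes "bounded A" "approx_lmo A f \<delta> x d" "0 < \<delta>" "a \<in> A"
  shows "\<delta> * \<bar>gradient f x \<bullet> a\<bar> \<le> (- gradient f x) \<bullet> d"
proof -
  have "bounded (sym_atoms A)" using assms(1)
    by (auto simp: sym_atoms_def bounded_uminus)
  then obtain b where b: "norm s \<le> b" if "s \<in> sym_atoms A" for s
    by (auto simp: bounded_iff)
  have bdd: "bdd_below ((\<lambda>s. gradient f x \<bullet> s) ` sym_atoms A)"
  proof (rule bdd_belowI2)
    fix s assume "s \<in> sym_atoms A"
    have "- (gradient f x \<bullet> s) \<le> norm (gradient f x) * norm s"
      using norm_cauchy_schwarz[of "- gradient f x" s] by simp
    also have "\<dots> \<le> norm (gradient f x) * b"
      using b[OF \<open>s \<in> _\<close>] by (simp add: mult_left_mono)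
    finally show "- (norm (gradient f x) * b) \<le> gradient f x \<bullet> s" by simp
  qed
  let ?I = "INF s\<in>sym_atoms A. gradient f x \<bullet> s"
  have "?I \<le> gradient f x \<bullet> a" "?I \<le> gradient f x \<bullet> (- a)"
    using assms(4) bdd by (auto intro!: cINF_lower simp: sym_atoms_def simp del: inner_minus_right)
  then have "\<bar>gradient f x \<bullet> a\<bar> \<le> - ?I" by (simp add: abs_le_iff)
  then have "\<delta> * \<bar>gradient f x \<bullet> a\<bar> \<le> \<delta> * - ?I" using assms(3) by (intro mult_left_mono) auto
  then show ?thesis using assms(2) by (simp add: approx_lmo_def)
qed

lemma norm_le_atoms_radius:
  assumes "bounded A" "d \<in> sym_atoms A"
  shows "norm d \<le> atoms_radius A"
proof -
  have "bdd_above (norm ` A)" using assms(1) by (auto simp: bounded_iff bdd_above_def)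
  then show ?thesis using assms(2)
    by (auto simp: sym_atoms_def atoms_radius_def intro: cSUP_upper)
qed

section \<open>Progress of one line search\<close>

text \<open>The estimate is only multiplied by \<open>\<tau>\<close> after a failure, hence only while it is below \<open>L\<close>, so it
  never overshoots \<open>\<tau> L\<close> unless it started above it.\<close>

lemma backtracks_bounds:
  assumes "backtracks f x d g \<tau> M M'" "\<And>M. M > 0 \<Longrightarrow> L \<le> M \<Longrightarrow> sufficient_decrease f x d g M"
    and "M > 0" "\<tau> > 1"
  shows "sufficient_decrease f x d g M' \<and> 0 < M' \<and> M' \<le> max M (\<tau> * L)"
  using assms(1,3)
proof induction
  case (accept M) then show ?case by simp
next
  case (increase M M')
  then have "M < L" using assms(2)[of M] by force
  then have "\<tau> * M \<le> \<tau> * L" using assms(4) by simp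
  moreover have "\<tau> * M > 0" using increase assms(4) by simp
  ultimately show ?case using increase.IH by auto
qed

lemma smooth_sufficient_decrease:
  fixes f :: "'a::euclidean_space \<Rightarrow> real"
  assumes "smooth_fun_on L D f" "\<And>s. x + s *\<^sub>R d \<in> D" "L \<le> M"
  shows "sufficient_decrease f x d ((- gradient f x) \<bullet> d) M"
proof -
  let ?g = "(- gradient f x) \<bullet> d"
  define \<gamma> where "\<gamma> = mp_step_size ?g d M"
  have "f (x + \<gamma> *\<^sub>R d) \<le> f x + gradient f x \<bullet> (\<gamma> *\<^sub>R d) + L / 2 * (norm (\<gamma> *\<^sub>R d))\<^sup>2"
    using assms(2) by (intro smooth_descent[OF assms(1)]) simp
  also have "\<dots> = f x - \<gamma> * ?g + L * ((\<gamma> * norm d)\<^sup>2 / 2)"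
    by (simp add: power_mult_distrib)
  also have "L * ((\<gamma> * norm d)\<^sup>2 / 2) \<le> M * ((\<gamma> * norm d)\<^sup>2 / 2)"
    using assms(3) by (intro mult_right_mono) auto
  finally show ?thesis
    by (simp add: sufficient_decrease_def Let_def \<gamma>_def power_mult_distrib mult_ac)
qed

text \<open>The step size \<open>g / (M \<parallel>d\<parallel>\<^sup>2)\<close> minimises the quadratic model on the right-hand side of the
  sufficient decrease condition. Hence the condition holds with any other \<open>\<gamma>\<close> in the model, and
  the analysis is free to choose a value of \<open>\<gamma>\<close> that the algorithm never computes.\<close>

lemma sufficient_decrease_progress:
  assumes "sufficient_decrease f x d g M" "0 < M" "0 < norm d" "norm d \<le> r"
    and "c \<le> g" "0 \<le> \<gamma>"
  shows "f (x + mp_step_size g d M *\<^sub>R d) \<le> f x - \<gamma> * c + \<gamma>\<^sup>2 * (M * r\<^sup>2) / 2"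
proof -
  define n where "n = norm d"
  have n: "n > 0" "n \<le> r" using assms by (auto simp: n_def)
  define K where "K = M * n\<^sup>2"
  have K: "K > 0" using assms n by (simp add: K_def)
  have "f (x + mp_step_size g d M *\<^sub>R d) \<le> f x - g / K * g + (g / K)\<^sup>2 * K / 2"
    using assms(1) unfolding sufficient_decrease_def Let_def mp_step_size_def n_def[symmetric]
    by (simp add: K_def mult_ac)
  also have "\<dots> = f x - g\<^sup>2 / (2 * K)" using K by (simp add: field_simps power2_eq_square)
  also have "\<dots> \<le> f x - \<gamma> * g + \<gamma>\<^sup>2 * K / 2"
  proof -
    \<comment> \<open>Completing the square in \<open>\<gamma>\<close>.\<close>
    have "0 \<le> (g - \<gamma> * K)\<^sup>2 / (2 * K)" using K by simp
    also have "\<dots> = g\<^sup>2 / (2 * K) - \<gamma> * g + \<gamma>\<^sup>2 * K / 2"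
      using K by (simp add: field_simps power2_eq_square)
    finally show ?thesis by simp
  qed
  also have "\<dots> \<le> f x - \<gamma> * c + \<gamma>\<^sup>2 * (M * r\<^sup>2) / 2"
  proof -
    have "\<gamma> * c \<le> \<gamma> * g" using assms by (simp add: mult_left_mono)
    moreover have "K \<le> M * r\<^sup>2" using n assms by (simp add: K_def power_mono)
    then have "\<gamma>\<^sup>2 * K \<le> \<gamma>\<^sup>2 * (M * r\<^sup>2)" by (simp add: mult_left_mono)
    ultimately show ?thesis by simp
  qed
  finally show ?thesis .
qed

section \<open>Solving the gap recursion\<close>

text \<open>A Lyapunov step: choosing \<open>\<gamma>\<close> so that the new weight times the contraction factor is the old
  weight makes \<open>a k * h k\<close> grow by at most \<open>l\<close> per step, so the sum telescopes.\<close>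

lemma weighted_gap_step:
  fixes h h' a a' b \<gamma> l :: real
  assumes "h' \<le> h - \<gamma> * (b * h) + \<gamma>\<^sup>2 * l / 2" "0 \<le> l" "0 \<le> a'"
    and "a' * (1 - \<gamma> * b) = a" "a' * \<gamma>\<^sup>2 \<le> 2"
  shows "a' * h' \<le> a * h + l"
proof -
  have "a' * h' \<le> a' * (h - \<gamma> * (b * h) + \<gamma>\<^sup>2 * l / 2)"
    using assms by (intro mult_left_mono)
  also have "\<dots> = (a' * (1 - \<gamma> * b)) * h + (a' * \<gamma>\<^sup>2) * (l / 2)"
    by (simp add: algebra_simps)
  also have "\<dots> \<le> a * h + 2 * (l / 2)"
    unfolding assms(4) using assms(2,5) by (intro add_left_mono mult_right_mono) auto
  finally show ?thesis by simp
qed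

text \<open>The weights \<open>(b k + 1) (b k + 1 - b) / 2\<close> come from \<open>\<gamma> = 2 / (b (k + 1) + 1)\<close>. They start at
  \<open>(1 - b) / 2\<close>, which produces the factor of the initial gap, and for \<open>b \<le> 1\<close> they dominate the
  weight \<open>b t (b t + 1) / 2\<close> of the conclusion.\<close>

lemma gap_rate_at_most_one:
  fixes h l :: "nat \<Rightarrow> real"
  assumes step: "\<And>k \<gamma>. k < t \<Longrightarrow> 0 \<le> \<gamma> \<Longrightarrow> h (Suc k) \<le> h k - \<gamma> * (b * h k) + \<gamma>\<^sup>2 * l k / 2"
    and l: "\<And>k. k < t \<Longrightarrow> 0 \<le> l k" and h: "\<And>k. k \<le> t \<Longrightarrow> 0 \<le> h k"
    and b: "0 < b" "b \<le> 1"
  shows "b * t * (b * t + 1) / 2 * h t \<le> (\<Sum>k<t. l k) + (1 - b) * h 0"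
proof -
  define a where "a k = (b * real k + 1) * (b * real k + 1 - b) / 2" for k :: nat
  have "a k * h k \<le> (\<Sum>i<k. l i) + (1 - b) / 2 * h 0" if "k \<le> t" for k
    using that
  proof (induction k)
    case 0
    then show ?case by (simp add: a_def)
  next
    case (Suc k)
    define v where "v = b * real k + 1"
    have v: "1 \<le> v" using b by (simp add: v_def)
    have a: "a (Suc k) = (v + b) * v / 2" "a k = v * (v - b) / 2"
      by (simp_all add: a_def v_def algebra_simps)
    define \<gamma> where "\<gamma> = 2 / (v + b)"
    have "0 < v + b" using v b by simp
    then have \<gamma>: "0 \<le> \<gamma>" "\<gamma> * (v + b) = 2" by (auto simp: \<gamma>_def simp del: distrib_left_numeral)
    have "0 \<le> \<gamma> * b" using \<gamma> b by simp
    then have "\<gamma> * v \<le> 2" using \<gamma>(2) unfolding distrib_left by linarith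
    have "a (Suc k) * h (Suc k) \<le> a k * h k + l k"
    proof (rule weighted_gap_step)
      show "h (Suc k) \<le> h k - \<gamma> * (b * h k) + \<gamma>\<^sup>2 * l k / 2" "0 \<le> l k"
        using step[of k \<gamma>] l[of k] Suc.prems \<gamma> by auto
      show "0 \<le> a (Suc k)" using v b by (simp add: a)
      show "a (Suc k) * (1 - \<gamma> * b) = a k"
        using \<open>0 < v + b\<close> by (simp add: a \<gamma>_def field_simps)
      have "a (Suc k) * \<gamma>\<^sup>2 = v * \<gamma> * (\<gamma> * (v + b)) / 2"
        by (simp add: a power2_eq_square)
      also have "\<dots> = \<gamma> * v" by (simp add: \<gamma>)
      finally show "a (Suc k) * \<gamma>\<^sup>2 \<le> 2" using \<open>\<gamma> * v \<le> 2\<close> by simp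
    qed
    then show ?case using Suc by simp
  qed
  then have *: "a t * h t \<le> (\<Sum>i<t. l i) + (1 - b) / 2 * h 0" by simp
  have "b * t * (b * t + 1) / 2 \<le> a t"
    using b mult_left_mono[of "b * t" "b * t + 1 - b" "b * t + 1"]
    by (simp add: a_def mult.commute)
  then have "b * t * (b * t + 1) / 2 * h t \<le> a t * h t"
    using h by (intro mult_right_mono) auto
  also note *
  also have "(1 - b) / 2 * h 0 \<le> (1 - b) * h 0"
    using b h[of 0] by (intro mult_right_mono) auto
  finally show ?thesis by simp
qed

text \<open>For \<open>b > 1\<close> the factor \<open>1 - b\<close> is negative, so the claim is stronger than what nonnegative
  weights give from time \<open>0\<close>. Now the weights of the conclusion can be used directly: the increment
  they require, \<open>a (k + 1) * \<gamma>\<^sup>2 \<le> 2\<close>, comes from \<open>(2 v + 1 - b)\<^sup>2 \<le> (2 v)\<^sup>2\<close>, where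
  \<open>v = b (k + 1)\<close>. Their value at \<open>0\<close> is \<open>0\<close>, so the induction starts at \<open>1\<close>, where the negative
  multiple of \<open>h 0\<close> is produced by a longer first step, with \<open>1 - b\<close> as the old weight.\<close>

lemma gap_rate_at_least_one:
  fixes h l :: "nat \<Rightarrow> real"
  assumes step: "\<And>k \<gamma>. k < t \<Longrightarrow> 0 \<le> \<gamma> \<Longrightarrow> h (Suc k) \<le> h k - \<gamma> * (b * h k) + \<gamma>\<^sup>2 * l k / 2"
    and l: "\<And>k. k < t \<Longrightarrow> 0 \<le> l k"
    and b: "1 \<le> b" and t: "1 \<le> t"
  shows "b * t * (b * t + 1) / 2 * h t \<le> (\<Sum>k<t. l k) + (1 - b) * h 0"
proof -
  define a where "a k = b * real k * (b * real k + 1) / 2" for k :: nat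
  have "a t * h t \<le> (\<Sum>k<t. l k) + (1 - b) * h 0"
    using t order_refl[of t]
  proof (induction t rule: dec_induct)
    case base
    \<comment> \<open>The value of \<open>\<gamma>\<close> for which the factor of \<open>h 0\<close> after weighting is exactly \<open>1 - b\<close>.\<close>
    define \<gamma> where "\<gamma> = (b\<^sup>2 + 3 * b - 2) / (b\<^sup>2 * (b + 1))"
    define u where "u = b - 1"
    have u: "u \<ge> 0" "b = 1 + u" using b by (auto simp: u_def)
    have "a (Suc 0) * h (Suc 0) \<le> (1 - b) * h 0 + l 0"
    proof (rule weighted_gap_step)
      have "0 \<le> b\<^sup>2 + 3 * b - 2" using u by (simp add: power2_eq_square algebra_simps)
      then have "0 \<le> \<gamma>" using b by (simp add: \<gamma>_def)
      then show "h (Suc 0) \<le> h 0 - \<gamma> * (b * h 0) + \<gamma>\<^sup>2 * l 0 / 2" "0 \<le> l 0"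
        using step[of 0 \<gamma>] l[of 0] t by auto
      show "0 \<le> a (Suc 0)" using b by (simp add: a_def)
      show "a (Suc 0) * (1 - \<gamma> * b) = 1 - b"
        using b by (simp add: a_def \<gamma>_def divide_simps add_eq_0_iff) (simp add: algebra_simps power2_eq_square)
      have "a (Suc 0) * \<gamma>\<^sup>2 = (b\<^sup>2 + 3 * b - 2)\<^sup>2 / (2 * (b ^ 3 * (b + 1)))"
        using b by (simp add: a_def \<gamma>_def divide_simps add_eq_0_iff)
          (simp add: algebra_simps eval_nat_numeral)
      \<comment> \<open>Expanding around \<open>b = 1\<close> shows the slack as a polynomial with nonnegative coefficients.\<close>
      moreover have "(b\<^sup>2 + 3 * b - 2)\<^sup>2 + (4 + 8 * u + 7 * u ^ 2 + 10 * u ^ 3 + 3 * u ^ 4)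
          = 2 * (2 * (b ^ 3 * (b + 1)))"
        unfolding u(2) by (simp add: algebra_simps eval_nat_numeral)
      then have "(b\<^sup>2 + 3 * b - 2)\<^sup>2 \<le> 2 * (2 * (b ^ 3 * (b + 1)))"
        using u(1) by (smt (verit) zero_le_power mult_nonneg_nonneg)
      ultimately show "a (Suc 0) * \<gamma>\<^sup>2 \<le> 2" using b by (simp add: divide_le_eq)
    qed
    then show ?case by simp
  next
    case (step k)
    define v where "v = b * real k + b"
    have v: "b \<le> v" "0 < v" using b by (auto simp: v_def add_nonneg_pos)
    have a: "a (Suc k) = v * (v + 1) / 2" "a k = (v - b) * (v - b + 1) / 2"
      by (simp_all add: a_def v_def algebra_simps)
    define \<gamma> where "\<gamma> = (2 * v + 1 - b) / (v * (v + 1))"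
    have nn: "0 \<le> 2 * v + 1 - b" using v by simp
    have "a (Suc k) * h (Suc k) \<le> a k * h k + l k"
    proof (rule weighted_gap_step)
      have "0 \<le> \<gamma>" using nn v by (simp add: \<gamma>_def)
      then show "h (Suc k) \<le> h k - \<gamma> * (b * h k) + \<gamma>\<^sup>2 * l k / 2" "0 \<le> l k"
        using assms(1)[of k \<gamma>] l[of k] step by auto
      show "0 \<le> a (Suc k)" using v by (simp add: a)
      show "a (Suc k) * (1 - \<gamma> * b) = a k"
        using v by (simp add: a \<gamma>_def divide_simps add_eq_0_iff) (simp add: algebra_simps power2_eq_square)
      have "a (Suc k) * \<gamma>\<^sup>2 = (2 * v + 1 - b)\<^sup>2 / (2 * (v * (v + 1)))"
        using v by (simp add: a \<gamma>_def divide_simps add_eq_0_iff) (simp add: algebra_simps power2_eq_square)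
      moreover have "(2 * v + 1 - b)\<^sup>2 \<le> (2 * v)\<^sup>2" using nn b by (intro power_mono) auto
      then have "(2 * v + 1 - b)\<^sup>2 \<le> 2 * (2 * (v * (v + 1)))"
        using v by (simp add: power2_eq_square algebra_simps)
      ultimately show "a (Suc k) * \<gamma>\<^sup>2 \<le> 2" using v by (simp add: divide_le_eq)
    qed
    then show ?case using step by simp
  qed
  then show ?thesis by (simp add: a_def)
qed

text \<open>The hypothesis says that the guaranteed upper bounds on the next gap are nonnegative, as they
  must be; the smallest of them, at \<open>\<gamma> = b h / l\<close>, gives the estimate.\<close>

lemma initial_gap_bound:
  fixes b h l :: real
  assumes "\<And>\<gamma>. 0 \<le> \<gamma> \<Longrightarrow> 0 \<le> h - \<gamma> * (b * h) + \<gamma>\<^sup>2 * l / 2" "0 < l" "0 \<le> h" "0 < b"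
  shows "b\<^sup>2 * h \<le> 2 * l"
proof (cases "h = 0")
  case False
  have "0 \<le> h - (b * h / l) * (b * h) + (b * h / l)\<^sup>2 * l / 2"
    using assms by (intro assms(1)) auto
  also have "\<dots> = h * (2 * l - b\<^sup>2 * h) / (2 * l)"
    using assms(2) by (simp add: field_simps power2_eq_square)
  finally show ?thesis using False assms(2,3) by (simp add: zero_le_divide_iff zero_le_mult_iff)
qed (use assms in simp)

text \<open>With \<open>S / t\<close> the average of the Lipschitz estimates, \<open>s\<close> the squared radius and \<open>c\<close> the initial
  gap, the two fractions of the rate share the denominator \<open>b t (b t + 1)\<close>.\<close>

lemma weighted_bound_eq_rate:
  fixes b s S c t :: real
  shows "2 * (S / t) * s / (b\<^sup>2 * t + b) + 2 * (1 - b) / (b\<^sup>2 * t\<^sup>2 + b * t) * c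
    = (S * s + (1 - b) * c) / (b * t * (b * t + 1) / 2)"
proof -
  define Q where "Q = b * t * (b * t + 1)"
  have "t * (b\<^sup>2 * t + b) = Q" "b\<^sup>2 * t\<^sup>2 + b * t = Q"
    by (simp_all add: Q_def algebra_simps power2_eq_square)
  moreover have "2 * (S / t) * s / (b\<^sup>2 * t + b) = 2 * (S * s) / (t * (b\<^sup>2 * t + b))" by simp
  moreover have "2 * (S * s) / Q + 2 * (1 - b) / Q * c = (S * s + (1 - b) * c) / (Q / 2)"
    by (cases "Q = 0") (simp_all add: field_simps)
  ultimately show ?thesis unfolding Q_def[symmetric] by (simp only:)
qed

text \<open>A large \<open>b\<close> would spoil a bound uniform in \<open>b\<close>, because of the factor \<open>1 - b\<close>. The a priori
  estimate of \<open>b\<^sup>2 * c\<close> absorbs it through \<open>\<bar>1 - b\<bar> \<le> 1 + b\<^sup>2\<close>.\<close>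

lemma abs_rate_le:
  fixes b s S c t K :: real
  assumes b: "0 < b" and t: "1 \<le> t" and S: "0 \<le> S" "S \<le> t * K" and s: "0 \<le> s"
    and c: "0 \<le> c" "b\<^sup>2 * c \<le> 2 * (K * s)"
  shows "\<bar>(S * s + (1 - b) * c) / (b * t * (b * t + 1) / 2)\<bar> \<le> (6 * K * s + 2 * c) * (1 / (b\<^sup>2 * t))"
proof -
  have "K \<ge> 0" using S t by (smt (verit) mult_pos_neg)
  have "0 \<le> (b - 1)\<^sup>2" by simp
  then have "2 * b \<le> b\<^sup>2 + 1" by (simp add: power2_diff)
  then have "\<bar>1 - b\<bar> \<le> 1 + b\<^sup>2"
    using b zero_le_power2[of b] by (intro abs_leI) linarith+
  then have "\<bar>1 - b\<bar> * c \<le> (1 + b\<^sup>2) * c" using c(1) by (rule mult_right_mono)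
  then have "\<bar>(1 - b) * c\<bar> \<le> c + 2 * (K * s)"
    using c by (simp add: abs_mult distrib_right)
  also have "\<dots> \<le> t * (c + 2 * (K * s))"
    using t c(1) s \<open>K \<ge> 0\<close> mult_right_mono[of 1 t "c + 2 * (K * s)"] by simp
  finally have "\<bar>(1 - b) * c\<bar> \<le> t * (c + 2 * (K * s))" .
  moreover have "0 \<le> S * s" "S * s \<le> t * K * s" using S s by (auto intro: mult_right_mono)
  ultimately have num: "\<bar>S * s + (1 - b) * c\<bar> \<le> t * (3 * K * s + c)"
    by (simp add: algebra_simps)
  have "b * t * (b * t) \<le> b * t * (b * t + 1)" using b t by (intro mult_left_mono) auto
  then have den: "(b * t)\<^sup>2 / 2 \<le> b * t * (b * t + 1) / 2" by (simp add: power2_eq_square)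
  have den_pos: "0 < (b * t)\<^sup>2 / 2" using b t by simp
  have "\<bar>(S * s + (1 - b) * c) / (b * t * (b * t + 1) / 2)\<bar>
      = \<bar>S * s + (1 - b) * c\<bar> / (b * t * (b * t + 1) / 2)"
    using den den_pos by (simp only: abs_divide abs_of_pos)
  also have "\<dots> \<le> t * (3 * K * s + c) / ((b * t)\<^sup>2 / 2)"
    by (rule frac_le[OF order_trans[OF abs_ge_zero num] num den_pos den])
  also have "\<dots> = (6 * K * s + 2 * c) * (1 / (b\<^sup>2 * t))"
    using b t by (simp add: field_simps power2_eq_square)
  finally show ?thesis .
qed

section \<open>The gap recursion along a run\<close>

text \<open>The point \<open>x0\<close> only fixes the level set to which \<open>R\<close> refers; it becomes the first iterate when
  runs are considered.\<close>

locale adamp_problem =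
  fixes A D :: "'a::euclidean_space set" and f :: "'a \<Rightarrow> real" and L \<delta> \<epsilon> \<tau> \<eta> :: real
    and x0 xstar :: 'a and R :: real
  assumes bounded: "bounded A" and nonempty: "A \<noteq> {}"
    and D: "open D" "span A \<subseteq> D" and f: "convex_on D f" "smooth_fun_on L D f"
    and xstar: "is_arg_min f (\<lambda>y. y \<in> span A) xstar"
    and params: "0 < \<delta>" "0 \<le> \<epsilon>" "0 < \<eta>" "1 < \<tau>"
    and R: "is_level_set_radius A f x0 xstar R"
begin

lemma optimal: "y \<in> span A \<Longrightarrow> f xstar \<le> f y" and xstar_span: "xstar \<in> span A"
  using xstar by (auto simp: is_arg_min_def not_less)

text \<open>Convexity bounds the primal gap by \<open>\<langle>\<nabla>f x, x - xstar\<rangle>\<close>; atomic norm duality and the oracle bound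
  this by \<open>R / \<delta>\<close> times the slope achieved by the chosen direction.\<close>

lemma gap_le_direction:
  assumes x: "x \<in> span A" "f x \<le> f x0" and d: "approx_lmo A f \<delta> x d"
  shows "\<delta> * (f x - f xstar) \<le> R * ((- gradient f x) \<bullet> d)"
proof -
  let ?g = "(- gradient f x) \<bullet> d" and ?N = "atomic_norm (sym_atoms A) (x - xstar)"
  have atom: "\<bar>gradient f x \<bullet> a\<bar> \<le> ?g / \<delta>" if "a \<in> A" for a
    using approx_lmo_gap[OF bounded d _ that] params by (simp only: pos_le_divide_eq mult.commute[of _ \<delta>])
  then have g: "0 \<le> ?g / \<delta>" using nonempty by fastforce
  have "f differentiable (at x)" using f x D by (auto simp: smooth_fun_on_def)
  then have "f x + gradient f x \<bullet> (xstar - x) \<le> f xstar"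
    using x(1) D(2) xstar_span by (intro convex_above_gradient[OF D(1) f(1)]) auto
  then have "f x - f xstar \<le> gradient f x \<bullet> (x - xstar)"
    by (simp add: inner_diff_right)
  also have "\<dots> \<le> ?g / \<delta> * ?N"
    using atom x xstar_span nonempty by (intro inner_le_atomic_norm span_diff)
  also have "\<dots> \<le> ?g / \<delta> * R"
    using R x g by (intro mult_left_mono) (auto simp: is_level_set_radius_def)
  finally show ?thesis using params by (simp add: field_simps)
qed

text \<open>A completed step has a direction with positive slope, hence strictly decreases \<open>f\<close>. This is
  incompatible with \<open>R \<le> 0\<close>, which would make \<open>x\<close> already optimal; so \<open>\<delta> / R\<close> is a genuine
  quotient.\<close>

lemma step_progress:
  assumes x: "x \<in> span A" "f x \<le> f x0" and Lprev: "0 < Lprev"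
    and step: "adamp_step A f \<delta> \<epsilon> \<tau> \<eta> x Lprev x' Lnew"
  defines "r \<equiv> atoms_radius A"
  shows "x' \<in> span A" "0 < Lnew" "Lnew \<le> max Lprev (\<tau> * L)" "0 < r" "0 < R"
    and "0 \<le> \<gamma> \<Longrightarrow> f x' - f xstar
      \<le> (f x - f xstar) - \<gamma> * (\<delta> / R * (f x - f xstar)) + \<gamma>\<^sup>2 * (Lnew * r\<^sup>2) / 2"
proof -
  obtain d M where d: "approx_lmo A f \<delta> x d" and g: "\<delta> * \<epsilon> < (- gradient f x) \<bullet> d"
    and M: "\<eta> * Lprev \<le> M" "M \<le> Lprev" and bt: "backtracks f x d ((- gradient f x) \<bullet> d) \<tau> M Lnew"
    and x': "x' = x + mp_step_size ((- gradient f x) \<bullet> d) d Lnew *\<^sub>R d"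
    using step by (auto simp: adamp_step_def Let_def)
  define g where "g = (- gradient f x) \<bullet> d"
  have "0 \<le> \<delta> * \<epsilon>" using params by simp
  with g have g_pos: "0 < g" by (simp add: g_def)
  then have d_pos: "0 < norm d" by (auto simp: g_def)
  have dA: "d \<in> sym_atoms A" using d by (simp add: approx_lmo_def)
  then have dr: "norm d \<le> r" unfolding r_def by (rule norm_le_atoms_radius[OF bounded])
  with d_pos show r: "0 < r" by linarith
  have "d \<in> span A" using dA by (auto simp: sym_atoms_def span_base span_neg)
  then have line: "x + s *\<^sub>R d \<in> span A" for s using x by (intro span_add span_scale)
  then show x'_span: "x' \<in> span A" by (simp add: x')
  have "0 < \<eta> * Lprev" using params Lprev by simp
  then have "0 < M" using M by simp
  have "sufficient_decrease f x d ((- gradient f x) \<bullet> d) N" if "L \<le> N" for N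
    using line D(2) that by (intro smooth_sufficient_decrease[OF f(2)]) auto
  from backtracks_bounds[OF bt this \<open>0 < M\<close>]
  have sd: "sufficient_decrease f x d g Lnew" and Lnew: "0 < Lnew" "Lnew \<le> max M (\<tau> * L)"
    using params by (auto simp: g_def)
  show "0 < Lnew" "Lnew \<le> max Lprev (\<tau> * L)" using Lnew M by auto
  have progress: "f x' \<le> f x - \<gamma> * c + \<gamma>\<^sup>2 * (Lnew * r\<^sup>2) / 2" if "c \<le> g" "0 \<le> \<gamma>" for c \<gamma>
    using sufficient_decrease_progress[OF sd Lnew(1) d_pos dr that] by (simp add: x' g_def)
  have gap: "\<delta> * (f x - f xstar) \<le> R * g"
    using gap_le_direction[OF x d] by (simp add: g_def)
  show "0 < R"
  proof (rule ccontr)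
    assume "\<not> 0 < R"
    then have "R * g \<le> 0" using g_pos by (simp add: mult_nonpos_nonneg)
    with gap params have "f x \<le> f xstar" by (smt (verit) mult_pos_pos)
    moreover have "f x' < f x"
    proof -
      define \<gamma> where "\<gamma> = g / (Lnew * r\<^sup>2)"
      have "0 < \<gamma>" using g_pos Lnew r by (simp add: \<gamma>_def)
      moreover have "\<gamma>\<^sup>2 * (Lnew * r\<^sup>2) = \<gamma> * g"
        using Lnew r by (simp add: \<gamma>_def power2_eq_square)
      ultimately show ?thesis using progress[of g \<gamma>] mult_pos_pos[OF _ g_pos, of \<gamma>] by linarith
    qed
    ultimately show False using optimal[OF x'_span] by simp
  qed
  then have "\<delta> / R * (f x - f xstar) \<le> g" using gap by (simp add: field_simps)
  then show "f x' - f xstar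
      \<le> (f x - f xstar) - \<gamma> * (\<delta> / R * (f x - f xstar)) + \<gamma>\<^sup>2 * (Lnew * r\<^sup>2) / 2" if "0 \<le> \<gamma>"
    using progress[OF _ that] by force
qed

text \<open>\<open>Lp k\<close> is the estimate available when iteration \<open>k\<close> begins; indexing the invariant by it covers
  the initial estimate and the later ones uniformly.\<close>

lemma run_invariant:
  assumes run: "adamp_run A f \<delta> \<epsilon> \<tau> \<eta> L_init t x Ls" and x0: "x0 = x 0" and "0 < L_init"
    and "k \<le> t"
  defines "Lp \<equiv> \<lambda>k. if k = 0 then L_init else Ls (k - 1)"
  shows "x k \<in> span A \<and> f (x k) \<le> f x0 \<and> 0 < Lp k \<and> Lp k \<le> max L_init (\<tau> * L)"
  using \<open>k \<le> t\<close>
proof (induction k)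
  case 0
  then show ?case using run assms(3) by (simp add: Lp_def adamp_run_def span_base x0)
next
  case (Suc k)
  then have IH: "x k \<in> span A" "f (x k) \<le> f x0" "0 < Lp k" "Lp k \<le> max L_init (\<tau> * L)" by auto
  have step: "adamp_step A f \<delta> \<epsilon> \<tau> \<eta> (x k) (Lp k) (x (Suc k)) (Ls k)"
    using run Suc.prems by (auto simp: adamp_run_def Lp_def)
  note sp = step_progress[OF IH(1-3) step]
  have "f (x (Suc k)) \<le> f (x k)" using sp(6)[of 0] by simp
  then show ?case using sp(1-3) IH by (auto simp: Lp_def)
qed

lemma run_recursion:
  assumes run: "adamp_run A f \<delta> \<epsilon> \<tau> \<eta> L_init t x Ls" and x0: "x0 = x 0" and L_init: "0 < L_init"
    and k: "k < t"
  shows "0 < Ls k" "Ls k \<le> max L_init (\<tau> * L)" "0 < R" "0 < atoms_radius A"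
    and "0 \<le> \<gamma> \<Longrightarrow> f (x (Suc k)) - f xstar \<le> (f (x k) - f xstar)
      - \<gamma> * (\<delta> / R * (f (x k) - f xstar)) + \<gamma>\<^sup>2 * (Ls k * (atoms_radius A)\<^sup>2) / 2"
proof -
  have inv: "x k \<in> span A" "f (x k) \<le> f x0" "0 < (if k = 0 then L_init else Ls (k - 1))"
    using run_invariant[OF run x0 L_init, of k] k by auto
  have step: "adamp_step A f \<delta> \<epsilon> \<tau> \<eta> (x k) (if k = 0 then L_init else Ls (k - 1)) (x (Suc k)) (Ls k)"
    using run k by (auto simp: adamp_run_def)
  show "0 < Ls k" "Ls k \<le> max L_init (\<tau> * L)"
    using run_invariant[OF run x0 L_init, of "Suc k"] k by auto
  show "0 < R" "0 < atoms_radius A"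
    using step_progress(4,5)[OF inv step] by auto
  show "f (x (Suc k)) - f xstar \<le> (f (x k) - f xstar)
      - \<gamma> * (\<delta> / R * (f (x k) - f xstar)) + \<gamma>\<^sup>2 * (Ls k * (atoms_radius A)\<^sup>2) / 2" if "0 \<le> \<gamma>"
    using step_progress(6)[OF inv step that] .
qed

lemma run_rate:
  assumes run: "adamp_run A f \<delta> \<epsilon> \<tau> \<eta> L_init t x Ls" and x0: "x0 = x 0" and L_init: "0 < L_init"
    and t: "1 \<le> t"
  defines "b \<equiv> \<delta> / R" and "s \<equiv> (atoms_radius A)\<^sup>2" and "S \<equiv> \<Sum>k<t. Ls k"
    and "h0 \<equiv> f x0 - f xstar" and "K \<equiv> max L_init (\<tau> * L)"
  shows "f (x t) - f xstar \<le> (S * s + (1 - b) * h0) / (b * t * (b * t + 1) / 2)"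
    and "\<bar>(S * s + (1 - b) * h0) / (b * t * (b * t + 1) / 2)\<bar>
      \<le> (6 * K * s + 2 * h0) * (1 / (b\<^sup>2 * t))"
proof -
  define h where "h k = f (x k) - f xstar" for k
  note rec = run_recursion[OF run x0 L_init]
  have "0 < R" using rec(3)[of 0] t by simp
  then have b: "0 < b" using params by (simp add: b_def)
  have s: "0 < s" using rec(4)[of 0] t by (simp add: s_def)
  have h: "0 \<le> h k" if "k \<le> t" for k
    using run_invariant[OF run x0 L_init that] optimal[of "x k"] by (auto simp: h_def)
  have step: "h (Suc k) \<le> h k - \<gamma> * (b * h k) + \<gamma>\<^sup>2 * (Ls k * s) / 2" if "k < t" "0 \<le> \<gamma>" for k \<gamma>
    using rec(5)[OF that] by (simp add: h_def b_def s_def)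
  have l: "0 \<le> Ls k * s" if "k < t" for k using rec(1)[OF that] s by simp
  have h0: "h 0 = h0" by (simp add: h_def h0_def x0)
  have "b * t * (b * t + 1) / 2 * h t \<le> (\<Sum>k<t. Ls k * s) + (1 - b) * h 0"
  proof (cases "b \<le> 1")
    case True
    show ?thesis by (rule gap_rate_at_most_one) (use step l h b True in auto)
  next
    case False
    show ?thesis by (rule gap_rate_at_least_one) (use step l t False in auto)
  qed
  then have "h t * (b * t * (b * t + 1) / 2) \<le> S * s + (1 - b) * h0"
    by (simp only: h0 S_def sum_distrib_right mult.commute[of "h t"])
  moreover have "0 < b * t * (b * t + 1) / 2" using b t by (simp add: add_pos_pos)
  ultimately show "f (x t) - f xstar \<le> (S * s + (1 - b) * h0) / (b * t * (b * t + 1) / 2)"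
    by (simp only: pos_le_divide_eq h_def)
  show "\<bar>(S * s + (1 - b) * h0) / (b * t * (b * t + 1) / 2)\<bar>
      \<le> (6 * K * s + 2 * h0) * (1 / (b\<^sup>2 * t))"
  proof (rule abs_rate_le)
    show "0 \<le> S" unfolding S_def using rec(1) by (intro sum_nonneg) (auto simp: less_imp_le)
    have "S \<le> of_nat (card {..<t}) * K"
      unfolding S_def K_def using rec(2) by (intro sum_bounded_above) auto
    then show "S \<le> real t * K" by simp
    have "b\<^sup>2 * h 0 \<le> 2 * (Ls 0 * s)"
    proof (rule initial_gap_bound)
      show "0 \<le> h 0 - \<gamma> * (b * h 0) + \<gamma>\<^sup>2 * (Ls 0 * s) / 2" if "0 \<le> \<gamma>" for \<gamma>
        using step[of 0 \<gamma>] h[of "Suc 0"] t that by auto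
      show "0 < Ls 0 * s" using rec(1)[of 0] t s by simp
    qed (use h b in auto)
    also have "Ls 0 * s \<le> K * s" using rec(2)[of 0] t s by (simp add: K_def)
    finally show "b\<^sup>2 * h0 \<le> 2 * (K * s)" by (simp add: h0)
    show "0 \<le> h0" using h[of 0] h0 by simp
  qed (use b t s in auto)
qed

end

theorem theorem3:
  fixes A :: "(real ^ 'p) set" and L L_init \<tau> h\<^sub>0 :: real
  assumes "bounded A" and "L_init > 0" and "\<tau> > 1"
  shows "\<exists>C. \<forall>(D :: (real ^ 'p) set) f xstar \<delta> \<epsilon> \<eta> R t x Ls.
    open D \<longrightarrow> span A \<subseteq> D \<longrightarrow> convex_on D f \<longrightarrow> smooth_fun_on L D f \<longrightarrow>
    is_arg_min f (\<lambda>y. y \<in> span A) xstar \<longrightarrow>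
    0 < \<delta> \<longrightarrow> \<delta> \<le> 1 \<longrightarrow> 0 \<le> \<epsilon> \<longrightarrow> 0 < \<eta> \<longrightarrow> \<eta> \<le> 1 \<longrightarrow>
    1 \<le> t \<longrightarrow> adamp_run A f \<delta> \<epsilon> \<tau> \<eta> L_init t x Ls \<longrightarrow>
    is_level_set_radius A f (x 0) xstar R \<longrightarrow>
    h\<^sub>0 = f (x 0) - f xstar \<longrightarrow>
    (let \<beta> = \<delta> / R; Lbar = (\<Sum>k<t. Ls k) / real t;
         bound = 2 * Lbar * (atoms_radius A)\<^sup>2 / (\<beta>\<^sup>2 * real t + \<beta>) +
                 2 * (1 - \<beta>) / (\<beta>\<^sup>2 * (real t)\<^sup>2 + \<beta> * real t) * h\<^sub>0
     in f (x t) - f xstar \<le> bound \<and>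
        \<bar>bound\<bar> \<le> C * (1 / (\<beta>\<^sup>2 * real t)))"
proof (rule exI[of _ "6 * max L_init (\<tau> * L) * (atoms_radius A)\<^sup>2 + 2 * h\<^sub>0"], intro allI impI, goal_cases)
  case (1 D f xstar \<delta> \<epsilon> \<eta> R t x Ls)
  interpret adamp_problem A D f L \<delta> \<epsilon> \<tau> \<eta> "x 0" xstar R
    using 1 assms by unfold_locales (auto simp: adamp_run_def)
  note rate = run_rate[OF \<open>adamp_run A f \<delta> \<epsilon> \<tau> \<eta> L_init t x Ls\<close> refl assms(2) \<open>1 \<le> t\<close>]
  show ?case
    unfolding Let_def weighted_bound_eq_rate \<open>h\<^sub>0 = f (x 0) - f xstar\<close>
    using rate by blast
qed

end
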